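(* Let $G$ be a König–Egerváry graph. Then: (i) $G-v$ is a König–Egerváry graph for every $v\in V(G)-\mathrm{core}(G)$; (ii) $G-v$ is not a König–Egerváry graph for every $v\in\mathrm{core}(G)-\ker(G)$; moreover, for such $v$, $G-v$ is a $1$-König–Egerváry graph; (iii) $G-v$ is a König–Egerváry graph for every $v\in\ker(G)$; (iv) $\varrho_v(G)=n(G)-\xi(G)+\varepsilon(G)$.
   Context: All graphs are finite, undirected, without loops or multiple edges; $n(G)=|V(G)|$. $\alpha(G)$ is the maximum size of an independent set of $G$ and $\mu(G)$ is the maximum size of a matching of $G$. $G$ is a König–Egerváry graph if $\alpha(G)+\mu(G)=n(G)$, and a $1$-König–Egerváry graph if $\alpha(G)+\mu(G)=n(G)-1$ (the graph with no vertices satisfies the first equality). For $A\subseteq V(G)$, $N(A)$ is the set of vertices having at least one neighbor in $A$. $d(G)=\max\{|A|-|N(A)|:A\subseteq V(G)\}$ is the critical difference (the maximum is also attained over independent sets), and an independent set $A$ (possibly empty) is a critical independent set if $|A|-|N(A)|=d(G)$. $\ker(G)$ is the intersection of all critical independent sets of $G$, and $\varepsilon(G)=|\ker(G)|$. $\mathrm{core}(G)$ is the intersection of all maximum independent sets of $G$, and $\xi(G)=|\mathrm{core}(G)|$. $G-v$ is the graph obtained by deleting the vertex $v$. $\varrho_v(G)$ is the number of vertices $v\in V(G)$ such that $G-v$ is a König–Egerváry graph. *)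

theory Defs
  imports "Graph_Theory.Digraph"
begin

text \<open>
  Finite simple undirected graphs are the locale \<open>graph\<close> of the Graph\_Theory library: finite
  symmetric digraphs without loops or parallel arcs, the null graph included. Each undirected edge
  is represented there by two opposite arcs, so edges are counted through \<open>edges\<close> below.
\<close>

definition edges :: "('a, 'b) pre_digraph \<Rightarrow> 'a set set" where
  "edges G = {{u, v} | u v. u \<rightarrow>\<^bsub>G\<^esub> v}"

definition independent_set :: "('a, 'b) pre_digraph \<Rightarrow> 'a set \<Rightarrow> bool" where
  "independent_set G S \<longleftrightarrow> S \<subseteq> verts G \<and> (\<forall>u\<in>S. \<forall>v\<in>S. \<not> u \<rightarrow>\<^bsub>G\<^esub> v)"

definition matching :: "('a, 'b) pre_digraph \<Rightarrow> 'a set set \<Rightarrow> bool" where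
  "matching G M \<longleftrightarrow> M \<subseteq> edges G \<and> pairwise disjnt M"

definition order :: "('a, 'b) pre_digraph \<Rightarrow> nat" where
  "order G = card (verts G)"

definition independence_number :: "('a, 'b) pre_digraph \<Rightarrow> nat" where
  "independence_number G = Max {card S | S. independent_set G S}"

definition matching_number :: "('a, 'b) pre_digraph \<Rightarrow> nat" where
  "matching_number G = Max {card M | M. matching G M}"

definition konig_egervary :: "('a, 'b) pre_digraph \<Rightarrow> bool" where
  "konig_egervary G \<longleftrightarrow> independence_number G + matching_number G = order G"

text \<open>The equation is taken in the integers: truncated subtraction would admit the null graph.\<close>

definition one_konig_egervary :: "('a, 'b) pre_digraph \<Rightarrow> bool" where
  "one_konig_egervary G \<longleftrightarrow>
     int (independence_number G) + int (matching_number G) = int (order G) - 1"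

text \<open>\<open>neighborhood G A\<close> may meet \<open>A\<close> itself.\<close>

definition neighborhood :: "('a, 'b) pre_digraph \<Rightarrow> 'a set \<Rightarrow> 'a set" where
  "neighborhood G A = {v \<in> verts G. \<exists>a\<in>A. v \<rightarrow>\<^bsub>G\<^esub> a}"

definition set_difference :: "('a, 'b) pre_digraph \<Rightarrow> 'a set \<Rightarrow> int" where
  "set_difference G A = int (card A) - int (card (neighborhood G A))"

definition critical_difference :: "('a, 'b) pre_digraph \<Rightarrow> int" where
  "critical_difference G = Max {set_difference G A | A. A \<subseteq> verts G}"

definition critical_independent_set :: "('a, 'b) pre_digraph \<Rightarrow> 'a set \<Rightarrow> bool" where
  "critical_independent_set G A \<longleftrightarrow>
     independent_set G A \<and> set_difference G A = critical_difference G"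

definition maximum_independent_set :: "('a, 'b) pre_digraph \<Rightarrow> 'a set \<Rightarrow> bool" where
  "maximum_independent_set G S \<longleftrightarrow> independent_set G S \<and> card S = independence_number G"

text \<open>
  For a finite graph neither intersection is over an empty family. In the case of \<open>ker\<close>: if \<open>A\<close>
  attains the critical difference, then so does the independent set \<open>A - neighborhood G A\<close>.
\<close>

definition ker :: "('a, 'b) pre_digraph \<Rightarrow> 'a set" where
  "ker G = \<Inter> {A. critical_independent_set G A}"

definition core :: "('a, 'b) pre_digraph \<Rightarrow> 'a set" where
  "core G = \<Inter> {S. maximum_independent_set G S}"

text \<open>The number of vertices whose deletion leaves a Koenig-Egervary graph.\<close>

definition rho_v :: "('a, 'b) pre_digraph \<Rightarrow> nat" where
  "rho_v G = card {v \<in> verts G. konig_egervary (pre_digraph.del_vert G v)}"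

end

theory Submission
  imports Defs
begin

text \<open>
  Let \<open>S\<close> be a maximum independent set of a Koenig-Egervary graph. A maximum matching has as many
  edges as \<open>S\<close> misses vertices, so it matches \<open>verts G - S\<close> into \<open>S\<close>; counting neighbours along it
  shows that the critical difference is the number \<open>\<alpha> - \<mu>\<close> of unmatched vertices, that \<open>S\<close> is
  critical, and that every critical set contains all unmatched vertices. Deleting \<open>v\<close> lowers \<open>\<alpha>\<close>
  iff \<open>v\<close> lies in the core, and preserves \<open>\<mu>\<close> iff some maximum matching misses \<open>v\<close>. Such a \<open>v\<close>
  lies in every critical set, hence in \<open>ker G\<close>. Conversely, if no maximum matching misses a given
  \<open>v \<in> S\<close>, then \<open>verts G - S\<close> cannot be matched into \<open>S - {v}\<close>, and a set \<open>B\<close> violating Hall's condition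
  yields the critical independent set \<open>S - neighborhood G B\<close>, which omits \<open>v\<close>.
\<close>

section \<open>Hall's marriage theorem\<close>

text \<open>Induction on \<open>card I\<close> in the style of Halmos and Vaughan. If a proper
  nonempty subfamily is tight, it and the rest, with the tight union removed, are solved separately.
  Otherwise every such subfamily has a spare element, so one representative can be chosen
  freely.\<close>

theorem hall_marriage:
  assumes "finite I" and "\<And>i. i \<in> I \<Longrightarrow> finite (A i)"
    and "\<And>J. J \<subseteq> I \<Longrightarrow> card J \<le> card (\<Union>(A ` J))"
  shows "\<exists>f. inj_on f I \<and> (\<forall>i\<in>I. f i \<in> A i)"
  using assms
proof (induction "card I" arbitrary: I A rule: less_induct)
  case less
  note fin = less.prems(1,2) and hall = less.prems(3)
  show ?case
  proof (cases "I = {}")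
    case False
    then obtain i where i: "i \<in> I" by blast
    show ?thesis
    proof (cases "\<exists>J. J \<subset> I \<and> J \<noteq> {} \<and> card (\<Union>(A ` J)) = card J")
      case True
      then obtain J where J: "J \<subset> I" "J \<noteq> {}" and tight: "card (\<Union>(A ` J)) = card J"
        by blast
      have finJ: "finite J" using J fin(1) by (meson finite_subset psubset_imp_subset)
      have "card J < card I" using J fin(1) by (simp add: psubset_card_mono)
      then have "\<exists>f. inj_on f J \<and> (\<forall>i\<in>J. f i \<in> A i)"
        using J finJ fin(2) hall by (intro less.hyps) auto
      then obtain f where f: "inj_on f J" "\<forall>i\<in>J. f i \<in> A i" by blast
      let ?U = "\<Union>(A ` J)"
      have finU: "finite ?U" using finJ fin(2) J by blast
      \<comment> \<open>Subtracting the tight count \<open>card J\<close> from Hall's condition for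
        \<open>J \<union> K\<close> leaves the condition for \<open>K\<close>.\<close>
      have hall': "card K \<le> card (\<Union>((\<lambda>i. A i - ?U) ` K))" if K: "K \<subseteq> I - J" for K
      proof -
        have finK: "finite K" using K fin(1) by (meson Diff_subset finite_subset)
        have finUK: "finite (\<Union>((\<lambda>i. A i - ?U) ` K))" using finK K fin(2) by auto
        have "card J + card K = card (J \<union> K)"
          using K finJ finK by (subst card_Un_disjoint) auto
        also have "\<dots> \<le> card (\<Union>(A ` (J \<union> K)))" using K J by (intro hall) auto
        also have "\<Union>(A ` (J \<union> K)) = ?U \<union> \<Union>((\<lambda>i. A i - ?U) ` K)" by auto
        also have "card \<dots> = card J + card (\<Union>((\<lambda>i. A i - ?U) ` K))"
          using finU finUK tight by (subst card_Un_disjoint) auto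
        finally show ?thesis by simp
      qed
      have "card (I - J) < card I"
        using J fin(1) by (intro psubset_card_mono) auto
      then have "\<exists>g. inj_on g (I - J) \<and> (\<forall>i\<in>I - J. g i \<in> A i - ?U)"
        using fin hall' by (intro less.hyps) auto
      then obtain g where g: "inj_on g (I - J)" "\<forall>i\<in>I - J. g i \<in> A i - ?U" by blast
      let ?h = "\<lambda>i. if i \<in> J then f i else g i"
      have "inj_on ?h I"
        unfolding inj_on_def
      proof (intro ballI impI)
        fix x y assume xy: "x \<in> I" "y \<in> I" and eq: "?h x = ?h y"
        \<comment> \<open>\<open>f\<close> takes its values inside \<open>?U\<close> and
          \<open>g\<close> outside it, so equal values come from the same side.\<close>
        have "x \<in> J \<longleftrightarrow> y \<in> J"
        proof (cases "x \<in> J"; cases "y \<in> J")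
          assume "x \<in> J" "y \<notin> J"
          then have "f x = g y" "f x \<in> ?U" "g y \<notin> ?U" using eq f(2) g(2) xy by (simp, blast, blast)
          then show ?thesis by metis
        next
          assume "x \<notin> J" "y \<in> J"
          then have "g x = f y" "f y \<in> ?U" "g x \<notin> ?U" using eq f(2) g(2) xy by (simp, blast, blast)
          then show ?thesis by metis
        qed auto
        then show "x = y"
          using eq xy f(1) g(1) by (cases "x \<in> J") (auto dest: inj_onD)
      qed
      moreover have "\<forall>i\<in>I. ?h i \<in> A i" using f(2) g(2) by auto
      ultimately show ?thesis by blast
    next
      case False
      have "card {i} \<le> card (A i)" using hall[of "{i}"] i by simp
      then obtain x where x: "x \<in> A i" by fastforce
      have hall': "card K \<le> card (\<Union>((\<lambda>j. A j - {x}) ` K))" if K: "K \<subseteq> I - {i}" for K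
      proof (cases "K = {}")
        case nonempty: False
        have finK: "finite K" using K fin(1) by (meson Diff_subset finite_subset)
        \<comment> \<open>As \<open>K\<close> is nonempty and omits \<open>i\<close>, it is not
          tight; the strict inequality pays for the loss of \<open>x\<close>.\<close>
        have "K \<subset> I" using K i by blast
        then have "card K < card (\<Union>(A ` K))"
          using False nonempty hall[of K] by (metis le_neq_implies_less psubset_imp_subset)
        also have "\<dots> \<le> card (\<Union>(A ` K) - {x}) + 1"
          using diff_card_le_card_Diff[of "{x}" "\<Union>(A ` K)"] by simp
        also have "\<Union>(A ` K) - {x} = \<Union>((\<lambda>j. A j - {x}) ` K)" by auto
        finally show ?thesis by simp
      qed simp
      have "card (I - {i}) < card I" using i fin(1) by (meson card_Diff1_less)
      then have "\<exists>g. inj_on g (I - {i}) \<and> (\<forall>j\<in>I - {i}. g j \<in> A j - {x})"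
        using fin hall' by (intro less.hyps) auto
      then obtain g where g: "inj_on g (I - {i})" "\<forall>j\<in>I - {i}. g j \<in> A j - {x}" by blast
      have "inj_on (g(i := x)) I"
        using g unfolding inj_on_def by (metis DiffD2 Diff_iff fun_upd_apply insertI1 singletonD)
      moreover have "\<forall>j\<in>I. (g(i := x)) j \<in> A j" using g(2) x by auto
      ultimately show ?thesis by blast
    qed
  qed simp
qed

section \<open>Adjacency, independent sets and matchings after deleting a vertex\<close>

lemma dominates_del_vert_iff:
  "u \<rightarrow>\<^bsub>pre_digraph.del_vert G x\<^esub> w \<longleftrightarrow> u \<rightarrow>\<^bsub>G\<^esub> w \<and> u \<noteq> x \<and> w \<noteq> x"
  by (auto simp: arcs_ends_conv pre_digraph.del_vert_simps)

lemma independent_set_del_vert_iff: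
  "independent_set (pre_digraph.del_vert G x) S \<longleftrightarrow> independent_set G S \<and> x \<notin> S"
  by (auto simp: independent_set_def dominates_del_vert_iff pre_digraph.verts_del_vert)

lemma matching_del_vert_iff:
  "matching (pre_digraph.del_vert G x) M \<longleftrightarrow> matching G M \<and> x \<notin> \<Union>M"
proof -
  have "edges (pre_digraph.del_vert G x) = {e \<in> edges G. x \<notin> e}"
    by (auto simp: edges_def dominates_del_vert_iff)
  then show ?thesis by (auto simp: matching_def)
qed

lemma (in graph) graph_del_vert: "graph (del_vert x)"
proof -
  interpret D: fin_digraph "del_vert x" by (rule fin_digraph_del_vert)
  show ?thesis
  proof unfold_locales
    show "symmetric (del_vert x)"
      using arcs_ends_symmetric[OF sym_arcs]
      by (auto simp: symmetric_def sym_def dominates_del_vert_iff)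
  qed (auto simp: del_vert_simps ends_del_vert no_loops no_multi_arcs)
qed

section \<open>Bounds and attainment for the extremal parameters\<close>

context graph
begin

lemma dominates_sym: "u \<rightarrow> w \<Longrightarrow> w \<rightarrow> u"
  using arcs_ends_symmetric[OF sym_arcs] .

lemma finite_independent_set: "independent_set G S \<Longrightarrow> finite S"
  by (auto simp: independent_set_def intro: finite_subset)

lemma Union_matching_subset: "matching G M \<Longrightarrow> \<Union>M \<subseteq> verts G"
  by (fastforce simp: matching_def edges_def dest: adj_in_verts)

lemma finite_matching: "matching G M \<Longrightarrow> finite M"
  using Union_matching_subset finite_verts finite_subset finite_UnionD by metis

lemma card_independent_sets_finite: "finite {card S | S. independent_set G S}"
proof -
  have "{card S | S. independent_set G S} \<subseteq> card ` Pow (verts G)"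
    by (auto simp: independent_set_def)
  then show ?thesis by (rule finite_subset) simp
qed

lemma card_matchings_finite: "finite {card M | M. matching G M}"
proof -
  have "{card M | M. matching G M} \<subseteq> card ` Pow (Pow (verts G))"
    using Union_matching_subset by blast
  then show ?thesis by (rule finite_subset) simp
qed

lemma card_le_independence_number: "independent_set G S \<Longrightarrow> card S \<le> independence_number G"
  unfolding independence_number_def using card_independent_sets_finite by (auto intro!: Max_ge)

lemma card_le_matching_number: "matching G M \<Longrightarrow> card M \<le> matching_number G"
  unfolding matching_number_def using card_matchings_finite by (auto intro!: Max_ge)

lemma ex_maximum_independent_set: "\<exists>S. maximum_independent_set G S"
proof -
  have "independent_set G {}" by (simp add: independent_set_def)
  then have "independence_number G \<in> {card S | S. independent_set G S}"
    unfolding independence_number_def using card_independent_sets_finite by (intro Max_in) auto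
  then show ?thesis by (auto simp: maximum_independent_set_def)
qed

lemma ex_maximum_matching: "\<exists>M. matching G M \<and> card M = matching_number G"
proof -
  have "matching G {}" by (simp add: matching_def)
  then have "matching_number G \<in> {card M | M. matching G M}"
    unfolding matching_number_def using card_matchings_finite by (intro Max_in) auto
  then show ?thesis by auto
qed

lemma set_difference_le_critical_difference:
  assumes "A \<subseteq> verts G"
  shows "set_difference G A \<le> critical_difference G"
proof -
  have "{set_difference G A | A. A \<subseteq> verts G} = set_difference G ` Pow (verts G)" by auto
  then show ?thesis
    unfolding critical_difference_def using assms by (auto intro!: Max_ge)
qed

lemma ex_critical_difference: "\<exists>A \<subseteq> verts G. set_difference G A = critical_difference G"
proof -
  have eq: "{set_difference G A | A. A \<subseteq> verts G} = set_difference G ` Pow (verts G)" by auto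
  have "critical_difference G \<in> set_difference G ` Pow (verts G)"
    unfolding critical_difference_def eq by (intro Max_in) auto
  then show ?thesis by auto
qed

section \<open>Counting along a matching\<close>

text \<open>Presents a matching as an involution on the vertices it covers. Being its own inverse,
  \<open>p\<close> is injective there, so the later counts become comparisons of images.\<close>

lemma matching_partner:
  assumes "matching G M"
  obtains p where "\<And>x. x \<in> \<Union>M \<Longrightarrow> x \<rightarrow> p x" "\<And>x. x \<in> \<Union>M \<Longrightarrow> p x \<in> \<Union>M"
    "\<And>x. x \<in> \<Union>M \<Longrightarrow> p (p x) = x"
proof -
  have uniq: "y = z" if "{x, y} \<in> M" "{x, z} \<in> M" for x y z
  proof -
    have "\<not> disjnt {x, y} {x, z}" by (auto simp: disjnt_def)
    then have "{x, y} = {x, z}" using assms that pairwiseD unfolding matching_def by metis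
    then show ?thesis by (metis doubleton_eq_iff)
  qed
  have "\<exists>y. {x, y} \<in> M \<and> x \<rightarrow> y" if "x \<in> \<Union>M" for x
  proof -
    from that obtain e where e: "e \<in> M" "x \<in> e" by blast
    with assms obtain u w where uw: "e = {u, w}" "u \<rightarrow> w" by (auto simp: matching_def edges_def)
    show ?thesis using e uw dominates_sym by (auto simp: insert_commute)
  qed
  then obtain p where p: "\<And>x. x \<in> \<Union>M \<Longrightarrow> {x, p x} \<in> M \<and> x \<rightarrow> p x" by metis
  have pM: "p x \<in> \<Union>M" if "x \<in> \<Union>M" for x using p[OF that] by blast
  have "p (p x) = x" if "x \<in> \<Union>M" for x
    using p[OF that] p[OF pM[OF that]] uniq[of "p x" "p (p x)" x] by (simp add: insert_commute)
  then show thesis using that p pM by blast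
qed

lemma card_Union_matching:
  assumes "matching G M"
  shows "card (\<Union>M) = 2 * card M"
proof -
  have two: "card e = 2" if e: "e \<in> M" for e
  proof -
    obtain u w where "e = {u, w}" "u \<rightarrow> w"
      using assms e unfolding matching_def edges_def by blast
    then show ?thesis using adj_not_same by (cases "u = w") auto
  qed
  have "card (\<Union>M) = sum card M"
    using assms two by (intro card_Union_disjoint) (auto simp: matching_def intro: card_ge_0_finite)
  then show ?thesis using two by simp
qed

text \<open>The partner map injects the covered part of \<open>A\<close> into
  \<open>neighborhood G A\<close>. The term \<open>A - \<Union>M\<close> is finer than the set of
  all unmatched vertices; this is what makes the equality case informative about critical
  sets.\<close>

lemma card_le_neighborhood_plus_unmatched:
  assumes "matching G M" "A \<subseteq> verts G"
  shows "card A \<le> card (neighborhood G A) + card (A - \<Union>M)"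
proof -
  have finA: "finite A" using assms(2) finite_subset[OF _ finite_verts] by blast
  obtain p where p: "\<And>x. x \<in> \<Union>M \<Longrightarrow> x \<rightarrow> p x" "\<And>x. x \<in> \<Union>M \<Longrightarrow> p x \<in> \<Union>M"
      "\<And>x. x \<in> \<Union>M \<Longrightarrow> p (p x) = x"
    using matching_partner[OF assms(1)] by blast
  have "inj_on p (A \<inter> \<Union>M)" using p(3) by (intro inj_on_inverseI[of _ p]) auto
  moreover have "p ` (A \<inter> \<Union>M) \<subseteq> neighborhood G A"
    using p(1) dominates_sym adj_in_verts unfolding neighborhood_def by blast
  moreover have "finite (neighborhood G A)" by (simp add: neighborhood_def)
  ultimately have "card (A \<inter> \<Union>M) \<le> card (neighborhood G A)" by (metis card_inj_on_le)
  then show ?thesis using card_Diff_subset_Int[of A "\<Union>M"] finA by simp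
qed

lemma independent_partner_image:
  assumes "independent_set G S" "S' \<subseteq> S" "\<And>x. x \<in> S' \<Longrightarrow> x \<rightarrow> p x"
  shows "p ` S' \<inter> S = {}"
  using assms unfolding independent_set_def by blast

text \<open>Partners of covered vertices of \<open>S\<close> lie outside \<open>S\<close>, so at
  least half of the \<open>2 * card M\<close> covered vertices are outside \<open>S\<close>.\<close>

lemma card_matching_le_outside:
  assumes "independent_set G S" "matching G M"
  shows "card M \<le> card (\<Union>M - S)"
proof -
  obtain p where p: "\<And>x. x \<in> \<Union>M \<Longrightarrow> x \<rightarrow> p x" "\<And>x. x \<in> \<Union>M \<Longrightarrow> p x \<in> \<Union>M"
      "\<And>x. x \<in> \<Union>M \<Longrightarrow> p (p x) = x"
    using matching_partner[OF assms(2)] by blast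
  have finU: "finite (\<Union>M)" using Union_matching_subset[OF assms(2)] finite_subset[OF _ finite_verts] by blast
  have "inj_on p (\<Union>M \<inter> S)" using p(3) by (intro inj_on_inverseI[of _ p]) auto
  moreover have "p ` (\<Union>M \<inter> S) \<subseteq> \<Union>M - S"
    using p(1,2) independent_partner_image[OF assms(1), of "\<Union>M \<inter> S" p] by blast
  ultimately have "card (\<Union>M \<inter> S) \<le> card (\<Union>M - S)" using finU by (metis card_inj_on_le finite_Diff)
  moreover have "card (\<Union>M \<inter> S) + card (\<Union>M - S) = 2 * card M"
    using card_Union_matching[OF assms(2)] finU card_Int_Diff[of "\<Union>M" S] by simp
  ultimately show ?thesis by simp
qed

lemma independence_plus_matching_le_order:
  "independence_number G + matching_number G \<le> order G"
proof -
  obtain S M where S: "independent_set G S" "card S = independence_number G"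
    and M: "matching G M" "card M = matching_number G"
    using ex_maximum_independent_set ex_maximum_matching by (auto simp: maximum_independent_set_def)
  have "card M \<le> card (\<Union>M - S)" using card_matching_le_outside S M by blast
  also have "\<dots> \<le> card (verts G - S)"
    using Union_matching_subset[OF M(1)] by (intro card_mono) auto
  also have "\<dots> = order G - card S"
    using S finite_independent_set by (auto simp: order_def independent_set_def card_Diff_subset)
  moreover have "card S \<le> order G"
    using S(1) unfolding order_def independent_set_def by (intro card_mono) auto
  ultimately show ?thesis using S M by linarith
qed

text \<open>Equality in the preceding count forces \<open>M\<close> to match all of
  \<open>verts G - S\<close> into \<open>S\<close>; the partners of \<open>B\<close> are then
  \<open>card B\<close> distinct neighbours in \<open>S\<close>.\<close>

lemma hall_condition_outside:
  assumes "independent_set G S" "matching G M" "card M = card (verts G - S)" "B \<subseteq> verts G - S"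
  shows "card B \<le> card (neighborhood G B \<inter> S)"
proof -
  obtain p where p: "\<And>x. x \<in> \<Union>M \<Longrightarrow> x \<rightarrow> p x" "\<And>x. x \<in> \<Union>M \<Longrightarrow> p x \<in> \<Union>M"
      "\<And>x. x \<in> \<Union>M \<Longrightarrow> p (p x) = x"
    using matching_partner[OF assms(2)] by blast
  have sub: "\<Union>M \<subseteq> verts G" by (rule Union_matching_subset[OF assms(2)])
  then have finU: "finite (\<Union>M)" using finite_subset[OF _ finite_verts] by blast
  \<comment> \<open>The left side is contained in the right and has at least \<open>card M\<close>
    elements, which is the size of the right.\<close>
  have out: "\<Union>M - S = verts G - S"
    using card_matching_le_outside[OF assms(1,2)] assms(3) sub by (intro card_seteq) auto
  have inj: "inj_on p (\<Union>M)" using p(3) by (intro inj_on_inverseI[of _ p]) auto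
  \<comment> \<open>Exactly half of the covered vertices lie outside \<open>S\<close>, hence the
    other half inside, and the injection between the halves is onto.\<close>
  have "p ` (\<Union>M \<inter> S) = \<Union>M - S"
  proof (rule card_seteq)
    show "p ` (\<Union>M \<inter> S) \<subseteq> \<Union>M - S"
      using p(1,2) independent_partner_image[OF assms(1), of "\<Union>M \<inter> S" p] by blast
    have "card (\<Union>M \<inter> S) + card (\<Union>M - S) = 2 * card M"
      using card_Union_matching[OF assms(2)] finU card_Int_Diff[of "\<Union>M" S] by simp
    moreover have "card (p ` (\<Union>M \<inter> S)) = card (\<Union>M \<inter> S)"
      using inj by (intro card_image) (auto intro: inj_on_subset)
    ultimately show "card (\<Union>M - S) \<le> card (p ` (\<Union>M \<inter> S))" using out assms(3) by simp
  qed (use finU in simp)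
  then have image: "p ` (\<Union>M \<inter> S) = verts G - S" by (simp only: out)
  have pB: "p b \<in> S" "b \<in> \<Union>M" if b: "b \<in> B" for b
  proof -
    show "b \<in> \<Union>M" using b assms(4) out by blast
    obtain s where "s \<in> \<Union>M" "s \<in> S" "b = p s" using b assms(4) image by blast
    then show "p b \<in> S" using p(3) by metis
  qed
  have "p ` B \<subseteq> neighborhood G B \<inter> S"
    using pB p(1) dominates_sym adj_in_verts unfolding neighborhood_def by blast
  moreover have "inj_on p B" using inj pB(2) by (auto intro: inj_on_subset)
  moreover have "finite (neighborhood G B \<inter> S)" by (simp add: neighborhood_def)
  ultimately show ?thesis by (metis card_inj_on_le)
qed

text \<open>Turns a choice of distinct representatives into a matching: with \<open>f\<close>
  injective and its image off \<open>X\<close>, two different pairs share no vertex.\<close>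

lemma matching_of_injection:
  assumes "inj_on f X" "f ` X \<inter> X = {}" "\<And>x. x \<in> X \<Longrightarrow> x \<rightarrow> f x"
  shows "matching G ((\<lambda>x. {x, f x}) ` X)" "card ((\<lambda>x. {x, f x}) ` X) = card X"
proof -
  have disj: "x = y \<or> disjnt {x, f x} {y, f y}" if "x \<in> X" "y \<in> X" for x y
    using that assms(1,2) by (auto simp: disjnt_def dest: inj_onD)
  have "pairwise disjnt ((\<lambda>x. {x, f x}) ` X)"
    unfolding pairwise_def using disj by blast
  then show "matching G ((\<lambda>x. {x, f x}) ` X)"
    using assms(3) by (auto simp: matching_def edges_def)
  have "inj_on (\<lambda>x. {x, f x}) X"
    using disj by (intro inj_onI) (auto simp: disjnt_def)
  then show "card ((\<lambda>x. {x, f x}) ` X) = card X" by (rule card_image)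
qed

section \<open>Change of the independence and matching numbers under deletion\<close>

lemma independence_number_del_vert_le: "independence_number (del_vert x) \<le> independence_number G"
proof -
  interpret D: graph "del_vert x" by (rule graph_del_vert)
  show ?thesis
    using D.ex_maximum_independent_set card_le_independence_number
    unfolding maximum_independent_set_def independent_set_del_vert_iff by metis
qed

lemma independence_number_le_del_vert: "independence_number G \<le> independence_number (del_vert x) + 1"
proof -
  interpret D: graph "del_vert x" by (rule graph_del_vert)
  obtain S where S: "independent_set G S" "card S = independence_number G"
    using ex_maximum_independent_set by (auto simp: maximum_independent_set_def)
  have "independent_set (del_vert x) (S - {x})"
    using S unfolding independent_set_del_vert_iff by (auto simp: independent_set_def)
  then have "card (S - {x}) \<le> independence_number (del_vert x)"
    by (rule D.card_le_independence_number)
  then show ?thesis using S(2) by (simp add: card_Diff_singleton_if split: if_splits)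
qed

text \<open>Independent sets after deletion are those of \<open>G\<close> avoiding \<open>x\<close>,
  so the value survives exactly when some maximum independent set avoids \<open>x\<close>.\<close>

lemma independence_number_del_vert_eq_iff:
  "independence_number (del_vert x) = independence_number G \<longleftrightarrow> x \<notin> core G"
proof -
  interpret D: graph "del_vert x" by (rule graph_del_vert)
  show ?thesis
  proof
    assume "independence_number (del_vert x) = independence_number G"
    then obtain S where "maximum_independent_set G S" "x \<notin> S"
      using D.ex_maximum_independent_set
      by (auto simp: maximum_independent_set_def independent_set_del_vert_iff)
    then show "x \<notin> core G" by (auto simp: core_def)
  next
    assume "x \<notin> core G"
    then obtain S where "maximum_independent_set G S" "x \<notin> S" by (auto simp: core_def)
    then have "independence_number G \<le> independence_number (del_vert x)"
      using D.card_le_independence_number[of S]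
      by (simp add: maximum_independent_set_def independent_set_del_vert_iff)
    then show "independence_number (del_vert x) = independence_number G"
      using independence_number_del_vert_le[of x] by simp
  qed
qed

lemma matching_number_del_vert_le: "matching_number (del_vert x) \<le> matching_number G"
proof -
  interpret D: graph "del_vert x" by (rule graph_del_vert)
  show ?thesis
    using D.ex_maximum_matching card_le_matching_number
    unfolding matching_del_vert_iff by metis
qed

lemma matching_number_le_del_vert: "matching_number G \<le> matching_number (del_vert x) + 1"
proof -
  interpret D: graph "del_vert x" by (rule graph_del_vert)
  obtain M where M: "matching G M" "card M = matching_number G"
    using ex_maximum_matching by blast
  let ?M = "{e \<in> M. x \<notin> e}"
  have "matching (del_vert x) ?M"
    using M(1) unfolding matching_del_vert_iff by (auto simp: matching_def pairwise_def)
  then have le: "card ?M \<le> matching_number (del_vert x)" by (rule D.card_le_matching_number)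
  \<comment> \<open>Two edges of \<open>M\<close> through \<open>x\<close> would meet, so deleting
    \<open>x\<close> destroys at most one edge.\<close>
  have "card (M - ?M) \<le> 1"
  proof -
    have "e = e'" if "e \<in> M - ?M" "e' \<in> M - ?M" for e e'
      using that M(1) by (auto simp: matching_def pairwise_def disjnt_iff)
    then show ?thesis using finite_matching[OF M(1)] by (auto simp: card_le_Suc0_iff_eq)
  qed
  moreover have "card M = card ?M + card (M - ?M)"
    using finite_matching[OF M(1)] card_Int_Diff[of M ?M] by (simp add: Int_absorb1)
  ultimately show ?thesis using le M(2) by linarith
qed

lemma matching_number_del_vert_eq_iff:
  "matching_number (del_vert x) = matching_number G
    \<longleftrightarrow> (\<exists>M. matching G M \<and> card M = matching_number G \<and> x \<notin> \<Union>M)"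
proof -
  interpret D: graph "del_vert x" by (rule graph_del_vert)
  show ?thesis
  proof
    assume "matching_number (del_vert x) = matching_number G"
    then show "\<exists>M. matching G M \<and> card M = matching_number G \<and> x \<notin> \<Union>M"
      using D.ex_maximum_matching by (auto simp: matching_del_vert_iff)
  next
    assume "\<exists>M. matching G M \<and> card M = matching_number G \<and> x \<notin> \<Union>M"
    then have "matching_number G \<le> matching_number (del_vert x)"
      using D.card_le_matching_number by (metis matching_del_vert_iff)
    then show "matching_number (del_vert x) = matching_number G"
      using matching_number_del_vert_le[of x] by simp
  qed
qed

lemma order_del_vert: "x \<in> verts G \<Longrightarrow> order G = order (del_vert x) + 1"
  unfolding order_def verts_del_vert using card_Suc_Diff1[of "verts G" x] by simp

end

section \<open>Critical sets, ker and core of a Koenig-Egervary graph\<close>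

locale konig_egervary_graph = graph +
  assumes konig_egervary: "konig_egervary G"
begin

lemma order_eq: "order G = independence_number G + matching_number G"
  using konig_egervary by (simp add: konig_egervary_def)

lemma card_outside_maximum_independent_set:
  assumes "maximum_independent_set G S"
  shows "card (verts G - S) = matching_number G"
proof -
  have S: "independent_set G S" "card S = independence_number G"
    using assms by (simp_all add: maximum_independent_set_def)
  then have "S \<subseteq> verts G" by (simp add: independent_set_def)
  then have "card (verts G - S) = order G - card S"
    using finite_independent_set[OF S(1)] by (simp add: order_def card_Diff_subset)
  then show ?thesis using order_eq S(2) by simp
qed

text \<open>A maximum matching covers 2\<mu> of the \<alpha> + \<mu> vertices.\<close>

lemma card_unmatched:
  assumes "matching G M" "card M = matching_number G"
  shows "int (card (verts G - \<Union>M)) = int (independence_number G) - int (matching_number G)"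
proof -
  have "card (\<Union>M) \<le> card (verts G)" "card (verts G - \<Union>M) = card (verts G) - card (\<Union>M)"
    using Union_matching_subset[OF assms(1)]
    by (simp_all add: card_mono card_Diff_subset finite_subset[OF _ finite_verts])
  then show ?thesis using card_Union_matching[OF assms(1)] assms(2) order_eq
    by (simp add: order_def)
qed

text \<open>The neighbourhood of \<open>S\<close> avoids \<open>S\<close>, and only \<mu> vertices
  remain outside. This is the half of the argument that makes \<open>S\<close> critical.\<close>

lemma set_difference_maximum_independent_set_ge:
  assumes "maximum_independent_set G S"
  shows "int (independence_number G) - int (matching_number G) \<le> set_difference G S"
proof -
  have "neighborhood G S \<subseteq> verts G - S"
    using assms by (auto simp: maximum_independent_set_def independent_set_def neighborhood_def)
  then have "card (neighborhood G S) \<le> matching_number G"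
    using card_outside_maximum_independent_set[OF assms] by (metis card_mono finite_Diff finite_verts)
  then show ?thesis using assms by (simp add: set_difference_def maximum_independent_set_def)
qed

lemma critical_difference_eq:
  "critical_difference G = int (independence_number G) - int (matching_number G)"
proof (rule antisym)
  obtain A M where A: "A \<subseteq> verts G" "set_difference G A = critical_difference G"
    and M: "matching G M" "card M = matching_number G"
    using ex_critical_difference ex_maximum_matching by blast
  have "card (A - \<Union>M) \<le> card (verts G - \<Union>M)" using A(1) by (intro card_mono) auto
  then show "critical_difference G \<le> int (independence_number G) - int (matching_number G)"
    using card_le_neighborhood_plus_unmatched[OF M(1) A(1)] card_unmatched[OF M] A(2)
    by (simp add: set_difference_def)
next
  obtain S where S: "maximum_independent_set G S" using ex_maximum_independent_set by blast
  then have "set_difference G S \<le> critical_difference G"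
    by (intro set_difference_le_critical_difference)
      (simp add: maximum_independent_set_def independent_set_def)
  then show "int (independence_number G) - int (matching_number G) \<le> critical_difference G"
    using set_difference_maximum_independent_set_ge[OF S] by simp
qed

lemma critical_independent_setI:
  assumes "independent_set G A"
    and "int (independence_number G) - int (matching_number G) \<le> set_difference G A"
  shows "critical_independent_set G A"
  using assms set_difference_le_critical_difference[of A] critical_difference_eq
  by (auto simp: critical_independent_set_def independent_set_def)

text \<open>Every maximum independent set is critical, so \<open>ker G\<close> intersects a larger
  family than \<open>core G\<close>.\<close>

lemma ker_subset_core: "ker G \<subseteq> core G"
  unfolding ker_def core_def
  using critical_independent_setI set_difference_maximum_independent_set_ge
  by (intro Inter_anti_mono subsetI) (simp add: maximum_independent_set_def)

lemma core_subset_verts: "core G \<subseteq> verts G"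
  using ex_maximum_independent_set
  unfolding core_def maximum_independent_set_def independent_set_def by blast

text \<open>For critical \<open>A\<close>, the excess over its neighbourhood equals the number of
  all unmatched vertices but is at most the number of those in \<open>A\<close>; hence
  \<open>A\<close> contains them all.\<close>

lemma unmatched_in_ker:
  assumes "matching G M" "card M = matching_number G" "x \<in> verts G - \<Union>M"
  shows "x \<in> ker G"
  unfolding ker_def
proof safe
  fix A assume "critical_independent_set G A"
  then have A: "A \<subseteq> verts G" "set_difference G A = critical_difference G"
    by (auto simp: critical_independent_set_def independent_set_def)
  then have "card (verts G - \<Union>M) \<le> card (A - \<Union>M)"
    using card_le_neighborhood_plus_unmatched[OF assms(1) A(1)] card_unmatched[OF assms(1,2)]
      critical_difference_eq by (simp add: set_difference_def)
  then have "A - \<Union>M = verts G - \<Union>M" using A(1) by (intro card_seteq) auto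
  then show "x \<in> A" using assms(3) by blast
qed

text \<open>Hall's theorem is applied to match \<open>verts G - S\<close> into
  \<open>S - {x}\<close>; such a matching has \<mu> edges and misses \<open>x\<close>. A violating
  \<open>B\<close> would produce a critical independent set without \<open>x\<close>.\<close>

lemma ker_unmatched:
  assumes "x \<in> ker G"
  shows "\<exists>M. matching G M \<and> card M = matching_number G \<and> x \<notin> \<Union>M"
proof -
  obtain S M where S: "maximum_independent_set G S" and M: "matching G M" "card M = matching_number G"
    using ex_maximum_independent_set ex_maximum_matching by blast
  then have indep: "independent_set G S" and cardS: "card S = independence_number G"
    by (auto simp: maximum_independent_set_def)
  let ?X = "verts G - S"
  have cardX: "card ?X = matching_number G" by (rule card_outside_maximum_independent_set[OF S])
  have xS: "x \<in> S" using assms ker_subset_core S by (auto simp: core_def)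
  have "\<exists>f. inj_on f ?X \<and> (\<forall>b\<in>?X. f b \<in> neighborhood G {b} \<inter> S - {x})"
  proof (rule hall_marriage)
    fix B assume B: "B \<subseteq> ?X"
    have finB: "finite B" using B finite_subset[OF _ finite_verts] by blast
    have finN: "finite (neighborhood G B)" by (simp add: neighborhood_def)
    have Un: "\<Union>((\<lambda>b. neighborhood G {b} \<inter> S - {x}) ` B) = neighborhood G B \<inter> S - {x}"
      by (auto simp: neighborhood_def)
    show "card B \<le> card (\<Union>((\<lambda>b. neighborhood G {b} \<inter> S - {x}) ` B))"
    proof (rule ccontr)
      assume "\<not> ?thesis"
      then have viol: "card (neighborhood G B \<inter> S - {x}) < card B" by (simp only: Un not_le)
      have hall: "card B \<le> card (neighborhood G B \<inter> S)"
        using hall_condition_outside indep M(1) B M(2) cardX by simp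
      \<comment> \<open>Hall's condition holds with \<open>x\<close> available and fails without it,
        so \<open>x\<close> is among the neighbours and the inequality with \<open>x\<close> is an
        equality.\<close>
      have xN: "x \<in> neighborhood G B \<inter> S"
        using viol hall by (metis Diff_empty Diff_insert0 not_le)
      have cardN: "card (neighborhood G B \<inter> S) = card B"
        using viol hall xN finN by (simp add: card_Diff_singleton_if)
      \<comment> \<open>Passing from \<open>S\<close> to \<open>?A\<close> removes
        \<open>card B\<close> vertices, but also keeps \<open>B\<close> out of the neighbourhood, so
        the difference does not fall below \<alpha> - \<mu>.\<close>
      let ?A = "S - neighborhood G B"
      have indepA: "independent_set G ?A" using indep by (auto simp: independent_set_def)
      \<comment> \<open>A vertex of \<open>B\<close> adjacent to some \<open>a\<close> in
        \<open>?A\<close> would put \<open>a\<close> into \<open>neighborhood G B\<close>.\<close>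
      have "neighborhood G ?A \<subseteq> ?X - B"
        using indep B dominates_sym by (fastforce simp: independent_set_def neighborhood_def)
      then have "card (neighborhood G ?A) \<le> card (?X - B)" by (intro card_mono) auto
      also have "\<dots> = matching_number G - card B" using B finB cardX by (simp add: card_Diff_subset)
      finally have "card (neighborhood G ?A) \<le> matching_number G - card B" .
      moreover have "card B \<le> matching_number G"
        using B cardX by (metis card_mono finite_Diff finite_verts)
      moreover have "card S = card B + card ?A"
        using finite_independent_set[OF indep] cardN card_Int_Diff[of S "neighborhood G B"]
        by (simp add: Int_commute)
      ultimately have "critical_independent_set G ?A"
        using indepA cardS by (intro critical_independent_setI) (auto simp: set_difference_def)
      then have "x \<in> ?A" using assms by (auto simp: ker_def)
      then show False using xN by simp
    qed
  qed (auto simp: neighborhood_def)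
  then obtain f where f: "inj_on f ?X" "\<And>b. b \<in> ?X \<Longrightarrow> f b \<in> neighborhood G {b} \<inter> S - {x}"
    by blast
  have adj: "b \<rightarrow> f b" if "b \<in> ?X" for b
    using f(2)[OF that] dominates_sym by (auto simp: neighborhood_def)
  have disj: "f ` ?X \<inter> ?X = {}" using f(2) by blast
  have "x \<notin> \<Union>((\<lambda>b. {b, f b}) ` ?X)" using f(2) xS by blast
  then show ?thesis
    using matching_of_injection[OF f(1) disj adj] cardX by metis
qed

section \<open>Deleting a vertex from a Koenig-Egervary graph\<close>

text \<open>The order drops by one, so exactly one of \<alpha> and \<mu> must drop. They drop by at
  most one each, and the general bound \<alpha> + \<mu> \<le> n for the smaller graph rules out that
  both survive; only the case that both drop fails.\<close>

lemma konig_egervary_del_vert_iff: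
  assumes "x \<in> verts G"
  shows "konig_egervary (del_vert x) \<longleftrightarrow> x \<notin> core G \<or> x \<in> ker G"
proof -
  interpret D: graph "del_vert x" by (rule graph_del_vert)
  have ker: "matching_number (del_vert x) = matching_number G \<longleftrightarrow> x \<in> ker G"
    using matching_number_del_vert_eq_iff ker_unmatched unmatched_in_ker assms by blast
  show ?thesis
    using ker independence_number_del_vert_eq_iff[of x] independence_number_del_vert_le[of x]
      independence_number_le_del_vert[of x] matching_number_del_vert_le[of x]
      matching_number_le_del_vert[of x] D.independence_plus_matching_le_order
      order_eq order_del_vert[OF assms]
    unfolding konig_egervary_def by linarith
qed

text \<open>Here both numbers drop by exactly one, leaving a sum one below the new order.\<close>

lemma one_konig_egervary_del_vert:
  assumes "x \<in> core G - ker G"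
  shows "one_konig_egervary (del_vert x)"
proof -
  have x: "x \<in> verts G" using assms core_subset_verts by blast
  have "matching_number (del_vert x) \<noteq> matching_number G"
    using matching_number_del_vert_eq_iff unmatched_in_ker assms x by blast
  moreover have "independence_number (del_vert x) \<noteq> independence_number G"
    using independence_number_del_vert_eq_iff assms by blast
  ultimately show ?thesis
    using independence_number_del_vert_le[of x] independence_number_le_del_vert[of x]
      matching_number_del_vert_le[of x] matching_number_le_del_vert[of x]
      order_eq order_del_vert[OF x]
    unfolding one_konig_egervary_def by linarith
qed

text \<open>The good vertices form the union of \<open>verts G - core G\<close> and
  \<open>ker G\<close>, disjoint because \<open>ker G\<close> lies in \<open>core G\<close>.\<close>

lemma rho_v_eq: "int (rho_v G) = int (order G) - int (card (core G)) + int (card (ker G))"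
proof -
  have fin: "finite (core G)" "finite (ker G)"
    using core_subset_verts ker_subset_core finite_subset[OF _ finite_verts] by (blast, blast)
  have "{x \<in> verts G. konig_egervary (del_vert x)} = (verts G - core G) \<union> ker G"
    using konig_egervary_del_vert_iff core_subset_verts ker_subset_core by blast
  moreover have "card ((verts G - core G) \<union> ker G) = card (verts G - core G) + card (ker G)"
    using fin ker_subset_core by (intro card_Un_disjoint) auto
  moreover have "card (verts G - core G) = card (verts G) - card (core G)"
    using fin core_subset_verts by (simp add: card_Diff_subset)
  moreover have "card (core G) \<le> card (verts G)"
    using core_subset_verts by (simp add: card_mono)
  ultimately show ?thesis by (simp add: rho_v_def order_def)
qed

end

theorem theorem3p2:
  fixes G :: "('a, 'b) pre_digraph"
  assumes "graph G"
    and "konig_egervary G"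
  shows "(\<forall>v \<in> verts G - core G. konig_egervary (pre_digraph.del_vert G v))
    \<and> (\<forall>v \<in> core G - ker G. \<not> konig_egervary (pre_digraph.del_vert G v)
          \<and> one_konig_egervary (pre_digraph.del_vert G v))
    \<and> (\<forall>v \<in> ker G. konig_egervary (pre_digraph.del_vert G v))
    \<and> int (rho_v G) = int (order G) - int (card (core G)) + int (card (ker G))"
proof -
  interpret konig_egervary_graph G
    using assms by (simp add: konig_egervary_graph_def konig_egervary_graph_axioms_def)
  show ?thesis
    using konig_egervary_del_vert_iff one_konig_egervary_del_vert rho_v_eq
      core_subset_verts ker_subset_core by blast
qed

end
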